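(* Let $n$ be a positive integer, let $\mathbb{X}$ be a real Banach space and let $T\in\mathbb{L}(\mathbb{X},\ell_\infty^n)$. (i) If $\|T\|=1$, then $T$ is left symmetric in $\mathbb{L}(\mathbb{X},\ell_\infty^n)$ if and only if there exist $j\in\{1,\dots,n\}$ and a left symmetric point $f$ of $\mathbb{X}^*$ with $\|f\|=1$ such that for every $x\in\mathbb{X}$, $Tx=(0,\dots,0,f(x),0,\dots,0)$ with $f(x)$ in the $j$-th coordinate. (ii) If $\|T\|=1$, then $T$ is right symmetric in $\mathbb{L}(\mathbb{X},\ell_\infty^n)$ if and only if there exist right symmetric points $f_1,\dots,f_n$ of $\mathbb{X}^*$ with $\|f_i\|=1$ for $1\le i\le n$ such that $Tx=(f_1(x),f_2(x),\dots,f_n(x))$ for every $x\in\mathbb{X}$. (iii) $T$ is symmetric in $\mathbb{L}(\mathbb{X},\ell_\infty^n)$ if and only if $T$ is the zero operator.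
   Context: $\ell_\infty^n$ is $\mathbb{R}^n$ with the norm $\|x\|_\infty=\max_i|x_i|$. $\mathbb{X}^*$ is the dual space of $\mathbb{X}$. $\mathbb{L}(\mathbb{X},\mathbb{Y})$ is the Banach space of bounded linear operators from $\mathbb{X}$ to $\mathbb{Y}$ with the operator norm. For a real Banach space $\mathbb{Z}$ and $x,y\in\mathbb{Z}$, $x\perp_B y$ means $\|x+\lambda y\|\ge\|x\|$ for all $\lambda\in\mathbb{R}$. A point $x\in\mathbb{Z}$ is left symmetric if for all $y\in\mathbb{Z}$, $x\perp_B y$ implies $y\perp_B x$; right symmetric if for all $y\in\mathbb{Z}$, $y\perp_B x$ implies $x\perp_B y$; symmetric if it is both left and right symmetric.
   Formalization: Part (iii) is stated only for n ≥ 2; for n = 1 it is false as written, since for X = ℝ the identity operator into ℓ_∞^1 is a nonzero symmetric point. *)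

theory Defs
  imports "HOL-Analysis.Analysis"
begin

definition bj_orth :: "'a::real_normed_vector \<Rightarrow> 'a \<Rightarrow> bool"  (infix "\<bottom>\<^sub>B" 50)
  where "x \<bottom>\<^sub>B y \<longleftrightarrow> (\<forall>r::real. norm (x + r *\<^sub>R y) \<ge> norm x)"

definition left_symmetric :: "'a::real_normed_vector \<Rightarrow> bool"
  where "left_symmetric x \<longleftrightarrow> (\<forall>y. x \<bottom>\<^sub>B y \<longrightarrow> y \<bottom>\<^sub>B x)"

definition right_symmetric :: "'a::real_normed_vector \<Rightarrow> bool"
  where "right_symmetric x \<longleftrightarrow> (\<forall>y. y \<bottom>\<^sub>B x \<longrightarrow> x \<bottom>\<^sub>B y)"

definition symmetric_point :: "'a::real_normed_vector \<Rightarrow> bool"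
  where "symmetric_point x \<longleftrightarrow> left_symmetric x \<and> right_symmetric x"

text \<open>The space $\ell_\infty^n$ with $n$ the cardinality of the index type.  The library's
  \<^typ>\<open>real ^ 'n\<close> carries the Euclidean norm, so the maximum norm needs a type of its own.\<close>

typedef 'n linf = "UNIV :: ('n::finite \<Rightarrow> real) set"
  morphisms coord linf ..

setup_lifting type_definition_linf

lemma coord_linf [simp]: "coord (linf f) = f"
  by (simp add: linf_inverse)

lemma linf_eqI: "(\<And>i. coord x i = coord y i) \<Longrightarrow> x = y"
  by (metis coord_inject ext)

instantiation linf :: (finite) real_vector
begin

lift_definition zero_linf :: "'a linf" is "\<lambda>_. 0" .
lift_definition plus_linf :: "'a linf \<Rightarrow> 'a linf \<Rightarrow> 'a linf" is "\<lambda>x y i. x i + y i" .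
lift_definition minus_linf :: "'a linf \<Rightarrow> 'a linf \<Rightarrow> 'a linf" is "\<lambda>x y i. x i - y i" .
lift_definition uminus_linf :: "'a linf \<Rightarrow> 'a linf" is "\<lambda>x i. - x i" .
lift_definition scaleR_linf :: "real \<Rightarrow> 'a linf \<Rightarrow> 'a linf" is "\<lambda>r x i. r * x i" .
instance
proof
  fix x y z :: "'a linf" and a b :: real
  show "x + y + z = x + (y + z)" "x + y = y + x" "0 + x = x" "- x + x = 0" "x - y = x + - y"
    by (transfer; auto)+
  show "a *\<^sub>R (x + y) = a *\<^sub>R x + a *\<^sub>R y" "(a + b) *\<^sub>R x = a *\<^sub>R x + b *\<^sub>R x"
    "a *\<^sub>R b *\<^sub>R x = (a * b) *\<^sub>R x" "1 *\<^sub>R x = x"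
    by (transfer; auto simp: algebra_simps)+
qed

end

instantiation linf :: (finite) real_normed_vector
begin

lift_definition norm_linf :: "'a linf \<Rightarrow> real" is "\<lambda>x. Max (range (\<lambda>i. \<bar>x i\<bar>))" .

definition dist_linf :: "'a linf \<Rightarrow> 'a linf \<Rightarrow> real"
  where "dist_linf x y = norm (x - y)"

definition sgn_linf :: "'a linf \<Rightarrow> 'a linf"
  where "sgn_linf x = x /\<^sub>R norm x"

definition uniformity_linf :: "('a linf \<times> 'a linf) filter"
  where "uniformity_linf = (INF e\<in>{0<..}. principal {(x, y). dist x y < e})"

definition open_linf :: "'a linf set \<Rightarrow> bool"
  where "open_linf U \<longleftrightarrow> (\<forall>x\<in>U. \<forall>\<^sub>F (x', y) in uniformity. x' = x \<longrightarrow> y \<in> U)"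

instance
proof
  fix x y :: "'a linf" and a :: real
  show "dist x y = norm (x - y)" "sgn x = x /\<^sub>R norm x"
    by (simp_all add: dist_linf_def sgn_linf_def)
  show "(uniformity :: ('a linf \<times> 'a linf) filter) =
      (INF e\<in>{0<..}. principal {(x, y). dist x y < e})"
    by (simp add: uniformity_linf_def)
  show "open U \<longleftrightarrow> (\<forall>x\<in>U. \<forall>\<^sub>F (x', y) in uniformity. x' = x \<longrightarrow> y \<in> U)" for U :: "'a linf set"
    by (simp add: open_linf_def)
  show "norm x = 0 \<longleftrightarrow> x = 0"
  proof transfer
    fix x :: "'a \<Rightarrow> real"
    have "x = (\<lambda>_. 0)" if M: "Max (range (\<lambda>i. \<bar>x i\<bar>)) = 0"
    proof
      fix i
      have "\<bar>x i\<bar> \<le> Max (range (\<lambda>i. \<bar>x i\<bar>))" by (rule Max_ge) auto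
      with M show "x i = 0" by simp
    qed
    then show "(Max (range (\<lambda>i. \<bar>x i\<bar>)) = 0) = (x = (\<lambda>_. 0))" by auto
  qed
  show "norm (x + y) \<le> norm x + norm y"
  proof transfer
    fix x y :: "'a \<Rightarrow> real"
    have "\<bar>x i + y i\<bar> \<le> Max (range (\<lambda>i. \<bar>x i\<bar>)) + Max (range (\<lambda>i. \<bar>y i\<bar>))" for i
      by (rule order_trans[OF abs_triangle_ineq add_mono]) (auto intro: Max_ge)
    then show "Max (range (\<lambda>i. \<bar>x i + y i\<bar>)) \<le>
        Max (range (\<lambda>i. \<bar>x i\<bar>)) + Max (range (\<lambda>i. \<bar>y i\<bar>))"
      by (subst Max_le_iff) auto
  qed
  show "norm (a *\<^sub>R x) = \<bar>a\<bar> * norm x"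
  proof transfer
    fix a :: real and x :: "'a \<Rightarrow> real"
    have "\<bar>a\<bar> * Max (range (\<lambda>i. \<bar>x i\<bar>)) = Max ((*) \<bar>a\<bar> ` range (\<lambda>i. \<bar>x i\<bar>))"
      by (rule mono_Max_commute) (auto simp: mono_def mult_left_mono)
    also have "(*) \<bar>a\<bar> ` range (\<lambda>i. \<bar>x i\<bar>) = range (\<lambda>i. \<bar>a * x i\<bar>)"
      by (auto simp: abs_mult)
    finally show "Max (range (\<lambda>i. \<bar>a * x i\<bar>)) = \<bar>a\<bar> * Max (range (\<lambda>i. \<bar>x i\<bar>))" by simp
  qed
qed

end

lemma norm_linf_eq: "norm x = Max (range (\<lambda>i. \<bar>coord x i\<bar>))"
  by (rule norm_linf.rep_eq)

lemma abs_coord_le_norm: "\<bar>coord x i\<bar> \<le> norm x"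
  unfolding norm_linf_eq by (rule Max_ge) auto

lemma norm_linf_le_iff: "norm x \<le> c \<longleftrightarrow> (\<forall>i. \<bar>coord x i\<bar> \<le> c)"
  unfolding norm_linf_eq by (subst Max_le_iff) auto

lemma bounded_linear_coord: "bounded_linear (\<lambda>x. coord x i)"
  by (rule bounded_linear_intro[where K = 1])
    (auto simp: plus_linf.rep_eq scaleR_linf.rep_eq abs_coord_le_norm)

instance linf :: (finite) banach
proof
  fix X :: "nat \<Rightarrow> 'a linf"
  assume "Cauchy X"
  then have "Cauchy (\<lambda>n. coord (X n) i)" for i
    by (rule bounded_linear.Cauchy[OF bounded_linear_coord])
  then have "\<exists>l. (\<lambda>n. coord (X n) i) \<longlonglongrightarrow> l" for i
    using Cauchy_convergent convergent_def by blast
  then obtain L where L: "\<And>i. (\<lambda>n. coord (X n) i) \<longlonglongrightarrow> L i" by metis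
  have "X \<longlonglongrightarrow> linf L"
  proof (rule tendstoI)
    fix e :: real assume e: "e > 0"
    have "\<forall>\<^sub>F n in sequentially. \<forall>i. dist (coord (X n) i) (L i) < e / 2"
      by (intro eventually_all_finite tendstoD[OF L]) (use e in simp)
    then show "\<forall>\<^sub>F n in sequentially. dist (X n) (linf L) < e"
    proof eventually_elim
      case (elim n)
      have "norm (X n - linf L) \<le> e / 2"
        unfolding norm_linf_le_iff
        using elim by (auto simp: minus_linf.rep_eq dist_real_def less_imp_le)
      then show ?case using e by (simp add: dist_linf_def)
    qed
  qed
  then show "convergent X" by (auto simp: convergent_def)
qed

text \<open>In dimension one a nonzero operator can be symmetric; hence the characterization of the
  symmetric operators as the zero operator is stated for $n \ge 2$ only.\<close>

lemma symmetric_point_nonzero_dim_one: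
  "\<exists>T :: real \<Rightarrow>\<^sub>L 1 linf. T \<noteq> 0 \<and> norm T = 1 \<and> symmetric_point T"
proof -
  have norm1: "norm (v :: 1 linf) = \<bar>coord v 1\<bar>" for v
    by (simp add: norm_linf_eq UNIV_1)
  have bl: "bounded_linear (\<lambda>x::real. linf (\<lambda>_::1. x))"
    by (rule bounded_linear_intro[where K = 1])
      (auto intro!: linf_eqI simp: plus_linf.rep_eq scaleR_linf.rep_eq norm1)
  define T where "T = Blinfun (\<lambda>x::real. linf (\<lambda>_::1. x))"
  have T: "blinfun_apply T x = linf (\<lambda>_. x)" for x
    unfolding T_def by (simp add: bounded_linear_Blinfun_apply[OF bl])
  have "norm T \<le> 1"
    by (rule norm_blinfun_bound) (auto simp: T norm1)
  moreover have "norm T \<ge> 1"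
    using norm_blinfun[of T 1] by (simp add: T norm1)
  ultimately have nT: "norm T = 1" by simp
  have span: "A = coord (blinfun_apply A 1) 1 *\<^sub>R T" for A
  proof (rule blinfun_eqI, rule linf_eqI)
    fix x :: real and i :: 1
    have "blinfun_apply A x = x *\<^sub>R blinfun_apply A 1"
      using blinfun.scaleR_right[of A x 1] by simp
    moreover have i: "i = 1" by simp
    ultimately show "coord (blinfun_apply A x) i =
        coord (blinfun_apply (coord (blinfun_apply A 1) 1 *\<^sub>R T) x) i"
      unfolding i by (simp add: blinfun.scaleR_left scaleR_linf.rep_eq T)
  qed
  have orth: "A = 0 \<or> B = 0" if "A \<bottom>\<^sub>B B" for A B :: "real \<Rightarrow>\<^sub>L 1 linf"
  proof -
    obtain a b where ab: "A = a *\<^sub>R T" "B = b *\<^sub>R T" using span by metis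
    have "a = 0" if "b \<noteq> 0"
      using \<open>A \<bottom>\<^sub>B B\<close>[unfolded bj_orth_def, rule_format, of "- a / b"] that
      by (simp add: ab nT flip: scaleR_add_left)
    with ab show ?thesis by auto
  qed
  have "B \<bottom>\<^sub>B A" if "A \<bottom>\<^sub>B B" for A B :: "real \<Rightarrow>\<^sub>L 1 linf"
    using orth[OF that] by (auto simp: bj_orth_def)
  then have "symmetric_point T"
    by (simp add: symmetric_point_def left_symmetric_def right_symmetric_def)
  with nT show ?thesis by (intro exI[of _ T]) auto
qed

end

theory Submission
  imports Defs
begin

text \<open>Through its coordinate functionals, an operator into \<open>\<ell>\<^sub>\<infinity>\<^sup>n\<close> is an element of the \<open>\<ell>\<^sub>\<infinity>\<close>-sum of
  \<open>n\<close> copies of the dual space.  In such a sum, \<open>A\<close> is orthogonal to \<open>B\<close> exactly when some coordinate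
  of \<open>A\<close> of maximal norm does not decrease in the direction of \<open>B\<close>, and some (possibly different) one
  does not decrease in the direction of \<open>-B\<close>.  With this criterion, every failure of symmetry is
  witnessed by altering a single coordinate.  The converse for right symmetric points rests on the
  fact that right symmetry of a vector also reverses one-sided orthogonality to it.\<close>

section \<open>One-sided Birkhoff-James orthogonality\<close>

definition bj_orth_plus :: "'a::real_normed_vector \<Rightarrow> 'a \<Rightarrow> bool"  (infix "\<bottom>\<^sub>+" 50)
  where "x \<bottom>\<^sub>+ y \<longleftrightarrow> (\<forall>r\<ge>0. norm x \<le> norm (x + r *\<^sub>R y))"

lemma bj_orth_iff_plus: "x \<bottom>\<^sub>B y \<longleftrightarrow> x \<bottom>\<^sub>+ y \<and> x \<bottom>\<^sub>+ - y"
proof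
  assume "x \<bottom>\<^sub>B y"
  then show "x \<bottom>\<^sub>+ y \<and> x \<bottom>\<^sub>+ - y"
    unfolding bj_orth_def bj_orth_plus_def by (metis scaleR_minus_left scaleR_minus_right)
next
  assume *: "x \<bottom>\<^sub>+ y \<and> x \<bottom>\<^sub>+ - y"
  show "x \<bottom>\<^sub>B y"
    unfolding bj_orth_def
  proof
    fix r :: real
    show "norm (x + r *\<^sub>R y) \<ge> norm x"
      using *[unfolded bj_orth_plus_def, THEN conjunct1, rule_format, of r]
        *[unfolded bj_orth_plus_def, THEN conjunct2, rule_format, of "- r"]
      by (cases "r \<ge> 0") auto
  qed
qed

lemma bj_orth_uminus_left: "- x \<bottom>\<^sub>B y \<longleftrightarrow> x \<bottom>\<^sub>B y"
proof -
  have "norm (- x + r *\<^sub>R y) = norm (x + (- r) *\<^sub>R y)" for r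
    using norm_minus_cancel[of "x + (- r) *\<^sub>R y"] by simp
  then show ?thesis
    unfolding bj_orth_def by (metis minus_minus norm_minus_cancel)
qed

lemma bj_orth_plus_zero [simp]: "x \<bottom>\<^sub>+ 0"
  by (simp add: bj_orth_plus_def)

lemma bj_orth_plus_scaleR_self:
  assumes "c \<ge> 0"
  shows "x \<bottom>\<^sub>+ c *\<^sub>R x"
  unfolding bj_orth_plus_def
proof (intro allI impI)
  fix r :: real assume "r \<ge> 0"
  then have "1 * norm x \<le> \<bar>1 + r * c\<bar> * norm x"
    using assms by (intro mult_right_mono) auto
  also have "\<dots> = norm (x + r *\<^sub>R c *\<^sub>R x)"
    by (metis norm_scaleR scaleR_add_left scaleR_one scaleR_scaleR)
  finally show "norm x \<le> norm (x + r *\<^sub>R c *\<^sub>R x)" by simp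
qed

lemma not_bj_orth_plus_scaleR_self:
  assumes "x \<noteq> 0" "c < 0"
  shows "\<not> x \<bottom>\<^sub>+ c *\<^sub>R x"
proof
  assume "x \<bottom>\<^sub>+ c *\<^sub>R x"
  \<comment> \<open>At this value of \<open>r\<close> the perturbed vector is
    \<open>x - x = 0\<close>.\<close>
  from this[unfolded bj_orth_plus_def, rule_format, of "- 1 / c"] assms show False by simp
qed

text \<open>By convexity the norm at step \<open>s\<close> is at most the mean of the norms at steps
  0 and \<open>r\<close> with weights \<open>1 - s / r\<close> and \<open>s / r\<close>; the second
  weight is positive, so strictness survives. This allows different step lengths to be replaced by a
  common smaller one.\<close>

lemma norm_add_scaleR_less:
  fixes x y :: "'a::real_normed_vector"
  assumes "norm x \<le> M" "norm (x + r *\<^sub>R y) < M" "0 < s" "s \<le> r"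
  shows "norm (x + s *\<^sub>R y) < M"
proof -
  define t where "t = s / r"
  have t: "0 < t" "t \<le> 1" "t * r = s" using assms by (auto simp: t_def)
  have "x + s *\<^sub>R y = (1 - t) *\<^sub>R x + t *\<^sub>R (x + r *\<^sub>R y)"
    using t by (simp add: algebra_simps)
  also have "norm \<dots> \<le> (1 - t) * norm x + t * norm (x + r *\<^sub>R y)"
    using t norm_triangle_ineq[of "(1 - t) *\<^sub>R x" "t *\<^sub>R (x + r *\<^sub>R y)"] by simp
  also have "\<dots> < (1 - t) * M + t * M"
    using t assms by (intro add_le_less_mono mult_left_mono mult_strict_left_mono) auto
  finally show ?thesis by (simp add: algebra_simps)
qed

text \<open>The norm along the line \<open>g + s *\<^sub>R f\<close> has a global minimum at some
  \<open>t \<le> 0\<close>, because \<open>g\<close> does not decrease in the direction of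
  \<open>f\<close>. At the minimizer the orthogonality to \<open>f\<close> is two-sided, so right
  symmetry applies; the sign of \<open>t\<close> then carries the result back from
  \<open>g + t *\<^sub>R f\<close> to \<open>g\<close>.\<close>

lemma right_symmetric_bj_orth_plus:
  fixes f g :: "'a::real_normed_vector"
  assumes sym: "right_symmetric f" and gf: "g \<bottom>\<^sub>+ f"
  shows "f \<bottom>\<^sub>+ g"
proof (cases "f = 0")
  case True
  then show ?thesis by (simp add: bj_orth_plus_def)
next
  case False
  \<comment> \<open>For \<open>\<bar>s\<bar> \<ge> R\<close> the vector \<open>s *\<^sub>R f\<close>
    has norm at least \<open>2 * norm g\<close>, so \<open>g + s *\<^sub>R f\<close> has norm at
    least \<open>norm g\<close>. A minimum over a compact interval is therefore global.\<close>
  define R where "R = 2 * norm g / norm f"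
  have "R \<ge> 0" by (simp add: R_def)
  have "\<exists>t\<in>{- R..0}. \<forall>s\<in>{- R..0}. norm (g + t *\<^sub>R f) \<le> norm (g + s *\<^sub>R f)"
    using \<open>R \<ge> 0\<close> by (intro continuous_attains_inf continuous_intros) auto
  then obtain t where t: "t \<in> {- R..0}"
    and min: "\<And>s. s \<in> {- R..0} \<Longrightarrow> norm (g + t *\<^sub>R f) \<le> norm (g + s *\<^sub>R f)"
    by blast
  have t0: "norm (g + t *\<^sub>R f) \<le> norm g" using min[of 0] \<open>R \<ge> 0\<close> by simp
  have all: "norm (g + t *\<^sub>R f) \<le> norm (g + s *\<^sub>R f)" for s
  proof -
    consider "s \<in> {- R..0}" | "s > 0" | "s < - R" by fastforce
    then show ?thesis
    proof cases
      case 2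
      then have "norm g \<le> norm (g + s *\<^sub>R f)" using gf by (simp add: bj_orth_plus_def)
      with t0 show ?thesis by simp
    next
      case 3
      then have "R * norm f \<le> \<bar>s\<bar> * norm f" using \<open>R \<ge> 0\<close> by (intro mult_right_mono) auto
      then have "2 * norm g \<le> norm (s *\<^sub>R f)" using False by (simp add: R_def)
      then show ?thesis
        using t0 norm_diff_ineq[of "s *\<^sub>R f" g] by (simp add: add.commute)
    qed (use min in auto)
  qed
  have "g + t *\<^sub>R f \<bottom>\<^sub>B f"
    unfolding bj_orth_def using all[of "t + r" for r] by (simp add: algebra_simps)
  then have orth: "f \<bottom>\<^sub>B g + t *\<^sub>R f" using sym by (simp add: right_symmetric_def)
  show ?thesis
    unfolding bj_orth_plus_def
  proof (intro allI impI)
    fix r :: real assume r: "r \<ge> 0"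
    \<comment> \<open>Chosen so that the coefficient \<open>q + r * t\<close> of \<open>f\<close> is
      1. Since \<open>t \<le> 0\<close>, the factor \<open>q\<close> is at least 1 and cannot shrink
      the norm.\<close>
    define q where "q = 1 - r * t"
    have q: "q \<ge> 1" using r t by (simp add: q_def mult_nonneg_nonpos)
    have eq: "f + r *\<^sub>R g = q *\<^sub>R (f + (r / q) *\<^sub>R (g + t *\<^sub>R f))"
    proof -
      have "q *\<^sub>R (f + (r / q) *\<^sub>R (g + t *\<^sub>R f)) = (q + r * t) *\<^sub>R f + r *\<^sub>R g"
        using q by (simp add: scaleR_add_right scaleR_add_left)
      then show ?thesis by (simp add: q_def)
    qed
    have "norm f \<le> norm (f + (r / q) *\<^sub>R (g + t *\<^sub>R f))"
      using orth by (simp add: bj_orth_def)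
    also have "\<dots> \<le> q * \<dots>" using q by (simp add: mult_le_cancel_right1)
    also have "\<dots> = norm (f + r *\<^sub>R g)" unfolding eq using q by simp
    finally show "norm f \<le> norm (f + r *\<^sub>R g)" .
  qed
qed

section \<open>Operators as finite families of functionals\<close>

definition component :: "'a::real_normed_vector \<Rightarrow>\<^sub>L 'n::finite linf \<Rightarrow> 'n \<Rightarrow> 'a \<Rightarrow>\<^sub>L real"
  where "component T i = Blinfun (\<lambda>x. coord (blinfun_apply T x) i)"

definition tuple :: "('n::finite \<Rightarrow> 'a::real_normed_vector \<Rightarrow>\<^sub>L real) \<Rightarrow> 'a \<Rightarrow>\<^sub>L 'n linf"
  where "tuple f = Blinfun (\<lambda>x. linf (\<lambda>i. blinfun_apply (f i) x))"

lemma component_apply [simp]: "blinfun_apply (component T i) x = coord (blinfun_apply T x) i"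
  unfolding component_def
  by (subst bounded_linear_Blinfun_apply)
    (auto intro: bounded_linear_compose[OF bounded_linear_coord blinfun.bounded_linear_right])

lemma tuple_apply [simp]: "blinfun_apply (tuple f) x = linf (\<lambda>i. blinfun_apply (f i) x)"
proof -
  have "bounded_linear (\<lambda>x. linf (\<lambda>i. blinfun_apply (f i) x))"
  proof (rule bounded_linear_intro)
    fix x
    have "norm (blinfun_apply (f i) x) \<le> norm x * (\<Sum>i\<in>UNIV. norm (f i))" for i
    proof -
      have "norm (blinfun_apply (f i) x) \<le> norm (f i) * norm x" by (rule norm_blinfun)
      also have "\<dots> \<le> (\<Sum>i\<in>UNIV. norm (f i)) * norm x"
        by (intro mult_right_mono member_le_sum) auto
      finally show ?thesis by (simp add: mult.commute)
    qed
    then show "norm (linf (\<lambda>i. blinfun_apply (f i) x)) \<le> norm x * (\<Sum>i\<in>UNIV. norm (f i))"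
      by (simp add: norm_linf_le_iff)
  qed (auto intro!: linf_eqI simp: plus_linf.rep_eq scaleR_linf.rep_eq blinfun.bilinear_simps)
  then show ?thesis by (simp add: tuple_def bounded_linear_Blinfun_apply)
qed

lemma component_tuple [simp]: "component (tuple f) i = f i"
  by (rule blinfun_eqI) simp

lemma tuple_component [simp]: "tuple (component T) = T"
  by (intro blinfun_eqI linf_eqI) simp

lemma component_add: "component (S + T) i = component S i + component T i"
  by (rule blinfun_eqI) (simp add: blinfun.add_left plus_linf.rep_eq)

lemma component_scaleR: "component (r *\<^sub>R T) i = r *\<^sub>R component T i"
  by (rule blinfun_eqI) (simp add: blinfun.scaleR_left scaleR_linf.rep_eq)

lemma component_uminus: "component (- T) i = - component T i"
  using component_scaleR[of "- 1" T i] by simp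

lemma norm_component_le: "norm (component T i) \<le> norm T"
proof (rule norm_blinfun_bound)
  fix x
  show "norm (blinfun_apply (component T i) x) \<le> norm T * norm x"
    using order_trans[OF abs_coord_le_norm norm_blinfun] by simp
qed simp

lemma norm_le_iff_component: "norm T \<le> c \<longleftrightarrow> (\<forall>i. norm (component T i) \<le> c)"
proof
  assume c: "\<forall>i. norm (component T i) \<le> c"
  show "norm T \<le> c"
  proof (rule norm_blinfun_bound)
    show "0 \<le> c" using c norm_ge_zero order_trans by blast
    fix x
    have "\<bar>coord (blinfun_apply T x) i\<bar> \<le> c * norm x" for i
      using norm_blinfun[of "component T i" x] c
      by (force intro: order_trans mult_right_mono)
    then show "norm (blinfun_apply T x) \<le> c * norm x"
      by (simp add: norm_linf_le_iff)
  qed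
qed (use norm_component_le order_trans in blast)

text \<open>Attainment is among the finitely many coordinates; no vector of the domain need attain a
  norm.\<close>

lemma norm_attained_component:
  obtains i where "norm (component T i) = norm T"
proof -
  let ?M = "Max (range (\<lambda>i. norm (component T i)))"
  have "norm T \<le> ?M" by (auto simp: norm_le_iff_component)
  moreover have "?M \<in> range (\<lambda>i. norm (component T i))" by (rule Max_in) auto
  then obtain i where "norm (component T i) = ?M" by force
  ultimately have "norm (component T i) = norm T"
    by (intro antisym norm_component_le) simp
  then show thesis by (rule that)
qed

lemma norm_eq_component:
  assumes "\<And>i. norm (component T i) \<le> c" "norm (component T j) = c"
  shows "norm T = c"
proof (rule antisym)
  show "norm T \<le> c" using assms by (simp add: norm_le_iff_component)
  show "c \<le> norm T" using assms norm_component_le[of T j] by simp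
qed

text \<open>If every coordinate dropped below \<open>norm A\<close> at some step of its own,
  convexity would make all of them drop at the smallest of these finitely many steps, and
  \<open>A\<close> with them. So one coordinate stays at or above \<open>norm A\<close> for all
  positive steps.\<close>

lemma bj_orth_plus_component_iff:
  "A \<bottom>\<^sub>+ B \<longleftrightarrow> (\<exists>i. norm (component A i) = norm A \<and> component A i \<bottom>\<^sub>+ component B i)"
proof
  assume orth: "A \<bottom>\<^sub>+ B"
  have "\<exists>i. \<forall>r>0. norm A \<le> norm (component A i + r *\<^sub>R component B i)"
  proof (rule ccontr)
    assume "\<nexists>i. \<forall>r>0. norm A \<le> norm (component A i + r *\<^sub>R component B i)"
    then have "\<forall>i. \<exists>r>0. norm (component A i + r *\<^sub>R component B i) < norm A"
      by (simp add: not_le)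
    then obtain r where r: "\<And>i. r i > 0"
      "\<And>i. norm (component A i + r i *\<^sub>R component B i) < norm A"
      by metis
    define s where "s = Min (range r)"
    have s: "s > 0" "\<And>i. s \<le> r i" by (auto simp: s_def r)
    obtain i where i: "norm (component (A + s *\<^sub>R B) i) = norm (A + s *\<^sub>R B)"
      by (rule norm_attained_component)
    have "norm (component A i + s *\<^sub>R component B i) < norm A"
      using norm_component_le r(2) s by (rule norm_add_scaleR_less)
    then have "norm (A + s *\<^sub>R B) < norm A"
      using i by (simp add: component_add component_scaleR)
    moreover have "norm A \<le> norm (A + s *\<^sub>R B)" using orth s by (simp add: bj_orth_plus_def)
    ultimately show False by simp
  qed
  then obtain i where i: "\<And>r. r > 0 \<Longrightarrow> norm A \<le> norm (component A i + r *\<^sub>R component B i)"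
    by blast
  \<comment> \<open>Letting the step tend to 0 shows that this coordinate itself has the maximal
    norm.\<close>
  have "((\<lambda>r. norm (component A i + r *\<^sub>R component B i)) \<longlongrightarrow>
      norm (component A i + 0 *\<^sub>R component B i)) (at_right 0)"
    by (intro tendsto_intros)
  then have "norm A \<le> norm (component A i + 0 *\<^sub>R component B i)"
  proof (rule tendsto_lowerbound)
    show "\<forall>\<^sub>F r in at_right 0. norm A \<le> norm (component A i + r *\<^sub>R component B i)"
      by (rule eventually_mono[OF eventually_at_right_less i])
  qed simp
  then have eq: "norm (component A i) = norm A"
    using norm_component_le[of A i] by simp
  have "component A i \<bottom>\<^sub>+ component B i"
    unfolding bj_orth_plus_def
  proof (intro allI impI)
    fix r :: real assume "r \<ge> 0"
    then show "norm (component A i) \<le> norm (component A i + r *\<^sub>R component B i)"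
      using i eq by (cases "r = 0") auto
  qed
  with eq show "\<exists>i. norm (component A i) = norm A \<and> component A i \<bottom>\<^sub>+ component B i"
    by blast
next
  assume "\<exists>i. norm (component A i) = norm A \<and> component A i \<bottom>\<^sub>+ component B i"
  then obtain i where i: "norm (component A i) = norm A" "component A i \<bottom>\<^sub>+ component B i"
    by blast
  show "A \<bottom>\<^sub>+ B"
    unfolding bj_orth_plus_def
  proof (intro allI impI)
    fix r :: real assume "r \<ge> 0"
    then have "norm A \<le> norm (component (A + r *\<^sub>R B) i)"
      using i by (simp add: bj_orth_plus_def component_add component_scaleR)
    then show "norm A \<le> norm (A + r *\<^sub>R B)" using norm_component_le order_trans by blast
  qed
qed

section \<open>Left symmetric operators\<close>

text \<open>Let \<open>A\<close> keep only a nonzero coordinate \<open>i\<close> of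
  \<open>T\<close>. Coordinate \<open>j\<close> of \<open>T\<close> is unaffected by adding
  multiples of \<open>A\<close>, so \<open>T\<close> is orthogonal to \<open>A\<close>. But the norm
  of \<open>A\<close> sits in coordinate \<open>i\<close> alone, which shrinks in the direction of
  \<open>- T\<close>.\<close>

lemma left_symmetric_component_eq_zero:
  assumes sym: "left_symmetric T" and j: "norm (component T j) = norm T" and "i \<noteq> j"
  shows "component T i = 0"
proof (rule ccontr)
  assume nz: "component T i \<noteq> 0"
  define A where "A = tuple (\<lambda>k. if k = i then component T i else 0)"
  have A: "component A k = (if k = i then component T i else 0)" for k
    by (simp add: A_def)
  have "T \<bottom>\<^sub>B A"
    unfolding bj_orth_iff_plus bj_orth_plus_component_iff component_uminus
    using j \<open>i \<noteq> j\<close> by (auto simp: A intro!: exI[of _ j])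
  then have "A \<bottom>\<^sub>+ - T"
    using sym by (simp add: left_symmetric_def bj_orth_iff_plus)
  then obtain k where k: "norm (component A k) = norm A" "component A k \<bottom>\<^sub>+ - component T k"
    by (auto simp: bj_orth_plus_component_iff component_uminus)
  have "norm A = norm (component T i)"
    by (rule norm_eq_component[where j = i]) (auto simp: A)
  with k nz have "k = i" by (auto simp: A split: if_splits)
  with k nz not_bj_orth_plus_scaleR_self[of "component T i" "- 1"] show False by (simp add: A)
qed

text \<open>Only coordinate \<open>j\<close> attains the norm of \<open>T\<close>, so orthogonality
  of \<open>T\<close> to an operator is decided there.\<close>

lemma left_symmetric_iff_single_component:
  assumes j: "norm (component T j) = norm T"
    and zero: "\<And>i. i \<noteq> j \<Longrightarrow> component T i = 0"
    and "T \<noteq> 0"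
  shows "left_symmetric T \<longleftrightarrow> left_symmetric (component T j)"
proof
  assume sym: "left_symmetric T"
  show "left_symmetric (component T j)"
    unfolding left_symmetric_def
  proof (intro allI impI)
    fix g assume g: "component T j \<bottom>\<^sub>B g"
    define A where "A = tuple (\<lambda>k. if k = j then g else 0)"
    have A: "component A k = (if k = j then g else 0)" for k
      by (simp add: A_def)
    have nA: "norm A = norm g"
      by (rule norm_eq_component[where j = j]) (auto simp: A)
    have "T \<bottom>\<^sub>B A"
      using g j unfolding bj_orth_iff_plus bj_orth_plus_component_iff component_uminus
      by (auto simp: A intro!: exI[of _ j])
    then have "A \<bottom>\<^sub>B T" using sym by (simp add: left_symmetric_def)
    \<comment> \<open>A witnessing coordinate other than \<open>j\<close> carries 0, so it attains
      \<open>norm A\<close> only if \<open>g = 0\<close>, when the claim is trivial.\<close>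
    then show "g \<bottom>\<^sub>B component T j"
      unfolding bj_orth_iff_plus bj_orth_plus_component_iff component_uminus
      by (auto simp: A nA bj_orth_plus_def split: if_splits)
  qed
next
  assume sym: "left_symmetric (component T j)"
  show "left_symmetric T"
    unfolding left_symmetric_def
  proof (intro allI impI)
    fix A assume "T \<bottom>\<^sub>B A"
    moreover have "k = j" if "norm (component T k) = norm T" for k
      using that zero \<open>T \<noteq> 0\<close> by force
    ultimately have "component T j \<bottom>\<^sub>B component A j"
      unfolding bj_orth_iff_plus bj_orth_plus_component_iff component_uminus by metis
    then have orth: "component A j \<bottom>\<^sub>B component T j"
      using sym by (simp add: left_symmetric_def)
    \<comment> \<open>\<open>A\<close> may attain its norm away from \<open>j\<close>, but there
      \<open>T\<close> vanishes and orthogonality is automatic.\<close>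
    obtain k where k: "norm (component A k) = norm A" by (rule norm_attained_component)
    have "component A k \<bottom>\<^sub>B component T k"
      using orth zero[of k] by (cases "k = j") (auto simp: bj_orth_def)
    then show "A \<bottom>\<^sub>B T"
      using k unfolding bj_orth_iff_plus bj_orth_plus_component_iff component_uminus by blast
  qed
qed

section \<open>Right symmetric operators\<close>

text \<open>If coordinate \<open>i\<close> falls short of \<open>norm T\<close>, replace it by a
  vector of full norm pointing the opposite way. The resulting \<open>A\<close> is orthogonal to
  \<open>T\<close>, yet the coordinates attaining \<open>norm T\<close> are shared with
  \<open>A\<close> and shrink in the direction of \<open>- A\<close>.\<close>

lemma right_symmetric_norm_component:
  assumes sym: "right_symmetric T"
  shows "norm (component T i) = norm T"
proof (rule ccontr)
  assume ne: "norm (component T i) \<noteq> norm T"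
  then have "T \<noteq> 0" using norm_component_le[of T i] by auto
  obtain j where j: "norm (component T j) = norm T" by (rule norm_attained_component)
  \<comment> \<open>If \<open>component T i = 0\<close>, it has no direction of its own and any vector of full norm serves.\<close>
  define u where "u = (if component T i = 0 then component T j
    else (norm T / norm (component T i)) *\<^sub>R component T i)"
  have nu: "norm u = norm T" by (simp add: u_def j)
  have u: "component T i = (norm (component T i) / norm T) *\<^sub>R u"
    using \<open>T \<noteq> 0\<close> by (simp add: u_def)
  define A where "A = tuple (\<lambda>k. if k = i then - u else component T k)"
  have A: "component A k = (if k = i then - u else component T k)" for k
    by (simp add: A_def)
  have nA: "norm A = norm T"
    by (rule norm_eq_component[where j = i]) (auto simp: A nu norm_component_le)
  have "i \<noteq> j" using ne j by auto
  \<comment> \<open>Coordinate \<open>j\<close> secures the direction of \<open>T\<close>, the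
    altered coordinate \<open>i\<close> that of \<open>- T\<close>.\<close>
  have "component A j \<bottom>\<^sub>+ component T j"
    using \<open>i \<noteq> j\<close> bj_orth_plus_scaleR_self[of 1 "component T j"] by (simp add: A)
  moreover have "component A i \<bottom>\<^sub>+ - component T i"
    using bj_orth_plus_scaleR_self[of "norm (component T i) / norm T" "- u"] u by (simp add: A)
  moreover have "norm (component A j) = norm A" "norm (component A i) = norm A"
    using \<open>i \<noteq> j\<close> j by (auto simp: A nA nu)
  ultimately have "A \<bottom>\<^sub>B T"
    unfolding bj_orth_iff_plus bj_orth_plus_component_iff component_uminus by blast
  then have "T \<bottom>\<^sub>+ - A" using sym by (simp add: right_symmetric_def bj_orth_iff_plus)
  then obtain k where k: "norm (component T k) = norm T" "component T k \<bottom>\<^sub>+ - component A k"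
    by (auto simp: bj_orth_plus_component_iff component_uminus)
  have "k \<noteq> i" using ne k by auto
  moreover have "component T k \<noteq> 0" using k \<open>T \<noteq> 0\<close> by auto
  ultimately show False
    using k not_bj_orth_plus_scaleR_self[of "component T k" "- 1"] by (simp add: A)
qed

text \<open>A vector orthogonal to \<open>component T i\<close> is extended to an operator
  \<open>A\<close> orthogonal to \<open>T\<close> whose other coordinates cannot witness the
  reversed relation, so coordinate \<open>i\<close> must. One direction at a time suffices, since
  \<open>- g\<close> may take the place of \<open>g\<close>.\<close>

lemma right_symmetric_component:
  assumes sym: "right_symmetric T"
  shows "right_symmetric (component T i)"
  unfolding right_symmetric_def
proof (intro allI impI)
  fix g assume g: "g \<bottom>\<^sub>B component T i"
  have plus: "component T i \<bottom>\<^sub>+ h" if h: "h \<bottom>\<^sub>B component T i" for h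
  proof (cases "h = 0 \<or> T = 0")
    case True
    then show ?thesis
      using norm_component_le[of T i] by (auto simp: bj_orth_plus_def)
  next
    case False
    \<comment> \<open>The negative sign makes the coordinates of \<open>T\<close> other than
      \<open>i\<close> shrink towards \<open>A\<close>; the size gives those of \<open>A\<close>
      norm exactly \<open>norm h\<close>, so that coordinate \<open>i\<close> attains
      \<open>norm A\<close>.\<close>
    define c where "c = - norm h / norm T"
    have c: "c < 0" "\<bar>c\<bar> * norm T = norm h" using False by (auto simp: c_def)
    define A where "A = tuple (\<lambda>k. if k = i then h else c *\<^sub>R component T k)"
    have A: "component A k = (if k = i then h else c *\<^sub>R component T k)" for k
      by (simp add: A_def)
    have nA: "norm A = norm h"
      by (rule norm_eq_component[where j = i])
        (auto simp: A c right_symmetric_norm_component[OF sym])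
    have "A \<bottom>\<^sub>B T"
      using h unfolding bj_orth_iff_plus bj_orth_plus_component_iff component_uminus
      by (auto simp: A nA intro!: exI[of _ i])
    then have "T \<bottom>\<^sub>+ A" using sym by (simp add: right_symmetric_def bj_orth_iff_plus)
    then obtain k where k: "norm (component T k) = norm T" "component T k \<bottom>\<^sub>+ component A k"
      by (auto simp: bj_orth_plus_component_iff)
    then have "component T k \<noteq> 0" using False by auto
    with k have "k = i"
      using c not_bj_orth_plus_scaleR_self[of "component T k" c]
      by (auto simp: A split: if_splits)
    with k show ?thesis by (simp add: A)
  qed
  show "component T i \<bottom>\<^sub>B g"
    unfolding bj_orth_iff_plus using plus[of g] plus[of "- g"] g by (simp add: bj_orth_uminus_left)
qed

text \<open>The two directions of \<open>A \<bottom>\<^sub>B T\<close> may be witnessed by different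
  coordinates, so it is one-sided orthogonality that must be reversed in each. The same witness
  serves afterwards because every coordinate of \<open>T\<close> attains the norm.\<close>

lemma right_symmetricI_component:
  assumes sym: "\<And>i. right_symmetric (component T i)"
    and norm: "\<And>i. norm (component T i) = norm T"
  shows "right_symmetric T"
  unfolding right_symmetric_def
proof (intro allI impI)
  fix A assume A: "A \<bottom>\<^sub>B T"
  have plus: "T \<bottom>\<^sub>+ B" if "B \<bottom>\<^sub>B T" for B
    using that right_symmetric_bj_orth_plus[OF sym] norm
    unfolding bj_orth_iff_plus bj_orth_plus_component_iff by blast
  show "T \<bottom>\<^sub>B A"
    unfolding bj_orth_iff_plus using plus[of A] plus[of "- A"] A by (simp add: bj_orth_uminus_left)
qed

section \<open>The three characterizations\<close>

lemma component_eq_iff: "(\<forall>x. blinfun_apply T x = linf (\<lambda>i. blinfun_apply (f i) x)) \<longleftrightarrow> component T = f"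
proof
  assume "\<forall>x. blinfun_apply T x = linf (\<lambda>i. blinfun_apply (f i) x)"
  then have "T = tuple f" by (intro blinfun_eqI) simp
  then show "component T = f" by auto
next
  assume "component T = f"
  then have "T = tuple f" by auto
  then show "\<forall>x. blinfun_apply T x = linf (\<lambda>i. blinfun_apply (f i) x)" by simp
qed

theorem theorem3p27:
  fixes T :: "'a::banach \<Rightarrow>\<^sub>L 'n::finite linf"
  shows
    "(norm T = 1 \<longrightarrow>
        (left_symmetric T \<longleftrightarrow>
          (\<exists>(j::'n) (f::'a \<Rightarrow>\<^sub>L real). left_symmetric f \<and> norm f = 1 \<and>
            (\<forall>x. blinfun_apply T x = linf (\<lambda>i. if i = j then blinfun_apply f x else 0)))))
     \<and> (norm T = 1 \<longrightarrow>
        (right_symmetric T \<longleftrightarrow>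
          (\<exists>f::'n \<Rightarrow> ('a \<Rightarrow>\<^sub>L real). (\<forall>i. right_symmetric (f i) \<and> norm (f i) = 1) \<and>
            (\<forall>x. blinfun_apply T x = linf (\<lambda>i. blinfun_apply (f i) x)))))
     \<and> (CARD('n) \<ge> 2 \<longrightarrow> (symmetric_point T \<longleftrightarrow> T = 0))"
proof (intro conjI impI)
  assume nT: "norm T = 1"
  \<comment> \<open>The conditional is moved inside \<open>blinfun_apply\<close>, which turns the
    single-coordinate form into an instance of \<open>component_eq_iff\<close>.\<close>
  have single: "(\<forall>x. blinfun_apply T x = linf (\<lambda>i. if i = j then blinfun_apply f x else 0)) \<longleftrightarrow>
      component T = (\<lambda>i. if i = j then f else 0)" for j f
  proof -
    have "(if i = j then blinfun_apply f x else 0) = blinfun_apply (if i = j then f else 0) x"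
      for i x by simp
    then show ?thesis by (simp only: component_eq_iff)
  qed
  show "left_symmetric T \<longleftrightarrow>
      (\<exists>(j::'n) (f::'a \<Rightarrow>\<^sub>L real). left_symmetric f \<and> norm f = 1 \<and>
        (\<forall>x. blinfun_apply T x = linf (\<lambda>i. if i = j then blinfun_apply f x else 0)))"
    unfolding single
  proof
    assume sym: "left_symmetric T"
    obtain j where j: "norm (component T j) = norm T" by (rule norm_attained_component)
    have zero: "component T i = 0" if "i \<noteq> j" for i
      using left_symmetric_component_eq_zero[OF sym j that] .
    have "left_symmetric (component T j)"
      using left_symmetric_iff_single_component[OF j zero] sym nT by fastforce
    moreover have "component T = (\<lambda>i. if i = j then component T j else 0)"
      using zero by auto
    ultimately show "\<exists>j f. left_symmetric f \<and> norm f = 1 \<and>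
        component T = (\<lambda>i. if i = j then f else 0)"
      using j nT by metis
  next
    assume "\<exists>j f. left_symmetric f \<and> norm f = 1 \<and> component T = (\<lambda>i. if i = j then f else 0)"
    then obtain j f where "left_symmetric f" "norm f = 1"
      "component T = (\<lambda>i. if i = j then f else 0)" by blast
    then show "left_symmetric T"
      using nT by (subst left_symmetric_iff_single_component[where j = j]) auto
  qed
next
  assume nT: "norm T = 1"
  show "right_symmetric T \<longleftrightarrow>
      (\<exists>f::'n \<Rightarrow> ('a \<Rightarrow>\<^sub>L real). (\<forall>i. right_symmetric (f i) \<and> norm (f i) = 1) \<and>
        (\<forall>x. blinfun_apply T x = linf (\<lambda>i. blinfun_apply (f i) x)))"
    unfolding component_eq_iff
    using right_symmetric_component[of T] right_symmetric_norm_component[of T]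
      right_symmetricI_component[of T] nT by auto
next
  assume card: "CARD('n) \<ge> 2"
  show "symmetric_point T \<longleftrightarrow> T = 0"
  proof
    assume sym: "symmetric_point T"
    obtain j where j: "norm (component T j) = norm T" by (rule norm_attained_component)
    \<comment> \<open>A second coordinate \<open>i\<close> must vanish by left symmetry and have
      norm \<open>norm T\<close> by right symmetry.\<close>
    have "UNIV \<noteq> {j}"
    proof
      assume "UNIV = {j}"
      then have "CARD('n) = 1" by (metis card_1_singleton_iff One_nat_def)
      with card show False by simp
    qed
    then obtain i where "i \<noteq> j" by blast
    then have "component T i = 0"
      using left_symmetric_component_eq_zero[OF _ j] sym by (auto simp: symmetric_point_def)
    then show "T = 0"
      using right_symmetric_norm_component[of T i] sym by (simp add: symmetric_point_def)
  next
    assume "T = 0"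
    then show "symmetric_point T"
      by (simp add: symmetric_point_def left_symmetric_def right_symmetric_def bj_orth_def)
  qed
qed

end
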